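(* For $i\ge 0$, let $S_i$ be the star graph with one central vertex and $i$ leaves (vertices adjacent only to the center), properly two-colored (center one color, leaves the other color). The Sprague–Grundy value of the \textsc{flag coloring} position on $S_i$ is $$\begin{cases} 0, & i=0,\\ \ast 1, & i \text{ odd},\\ \ast 2, & i\ge 2 \text{ and } i \text{ even}.\end{cases}$$
   Context: \textsc{flag coloring} is an impartial two-player game played on a simple graph whose vertices are colored. A move consists of choosing a vertex $v$, of color $c$ say, and a color $c'\neq c$ that is the color of some vertex adjacent to $v$; then $v$ and every vertex of the connected component of the subgraph induced by color-$c$ vertices that contains $v$ are recolored $c'$. Play is under the normal play convention: a player unable to move loses. Each position gets a Sprague–Grundy value (nimber) $\ast n$, where $n$ is the minimum non-negative integer not among the values of its options (positions with no options have value $0$); $\ast 1$ is also written $\ast$. *)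

theory Defs
  imports "Graph_Theory.Graph_Theory"
begin

text \<open>
  An impartial game is given by the set of options of each position.  The Sprague--Grundy value is
  an inductive relation so that no termination argument is needed to define it: a position has
  a value only if every play from it terminates, and then the value is unique.
  The natural number \<open>n\<close> stands for the nimber \<open>*n\<close>.
\<close>

definition is_mex :: "nat \<Rightarrow> nat set \<Rightarrow> bool" where
  "is_mex n A \<longleftrightarrow> n \<notin> A \<and> (\<forall>m<n. m \<in> A)"

inductive sg_value :: "('p \<Rightarrow> 'p set) \<Rightarrow> 'p \<Rightarrow> nat \<Rightarrow> bool" for opts :: "'p \<Rightarrow> 'p set" where
  sg_valueI: "\<lbrakk>\<forall>q \<in> opts p. sg_value opts q (g q); is_mex n (g ` opts p)\<rbrakk> \<Longrightarrow> sg_value opts p n"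

lemma is_mex_unique: "is_mex m A \<Longrightarrow> is_mex n A \<Longrightarrow> m = n"
  unfolding is_mex_def by (metis linorder_neqE_nat)

lemma sg_value_unique: "sg_value opts p m \<Longrightarrow> sg_value opts p n \<Longrightarrow> m = n"
proof (induction arbitrary: n rule: sg_value.induct)
  case (sg_valueI p g m)
  from sg_valueI.prems obtain h
    where h: "\<forall>q \<in> opts p. sg_value opts q (h q)" "is_mex n (h ` opts p)"
    by (cases rule: sg_value.cases) auto
  have "g ` opts p = h ` opts p"
    using sg_valueI.IH h(1) by (intro image_cong) auto
  then show ?case
    using sg_valueI.hyps h(2) is_mex_unique by metis
qed

text \<open>
  A finite simple graph is a \<^term>\<open>G\<close> with \<open>pair_graph G\<close>, each edge being a pair of opposite arcs.
  A coloring is a total function; its values outside \<open>pverts G\<close> never matter and never change.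
\<close>

definition mono_component :: "'v pair_pre_digraph \<Rightarrow> ('v \<Rightarrow> 'k) \<Rightarrow> 'v \<Rightarrow> 'v set" where
  "mono_component G col v =
     {u. v \<rightarrow>\<^sup>*\<^bsub>with_proj G \<restriction> {w \<in> pverts G. col w = col v}\<^esub> u}"

definition flag_moves :: "'v pair_pre_digraph \<Rightarrow> ('v \<Rightarrow> 'k) \<Rightarrow> ('v \<Rightarrow> 'k) set" where
  "flag_moves G col =
     {(\<lambda>u. if u \<in> mono_component G col v then c' else col u) | v c'.
        v \<in> pverts G \<and> c' \<noteq> col v \<and> (\<exists>w. v \<rightarrow>\<^bsub>with_proj G\<^esub> w \<and> col w = c')}"

definition star_graph :: "'v \<Rightarrow> 'v set \<Rightarrow> 'v pair_pre_digraph" where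
  "star_graph x L = \<lparr> pverts = insert x L, parcs = {x} \<times> L \<union> L \<times> {x} \<rparr>"

lemma pair_graph_star_graph:
  assumes "finite L" "x \<notin> L"
  shows "pair_graph (star_graph x L)"
  using assms
  by unfold_locales (auto simp: star_graph_def symmetric_def intro!: symI)

end

theory Submission
  imports Defs
begin

text \<open>
  Throughout play the star carries at most two colours, and the value depends only on the number
  \<open>n\<close> of leaves whose colour differs from that of the centre.  If \<open>n > 0\<close>, recolouring the centre
  makes the star monochromatic, while recolouring one of these leaves decreases \<open>n\<close> by one; a leaf
  that agrees with the centre has no move.  Hence the value satisfies \<open>v 0 = 0\<close> and
  \<open>v n = mex {0, v (n - 1)}\<close>.
\<close>

lemma arc_star_graph_iff:
  "u \<rightarrow>\<^bsub>with_proj (star_graph x L)\<^esub> w \<longleftrightarrow> u = x \<and> w \<in> L \<or> u \<in> L \<and> w = x"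
  by (auto simp: star_graph_def arcs_ends_conv)

lemma arc_star_graph_induced_iff:
  "u \<rightarrow>\<^bsub>with_proj (star_graph x L) \<restriction> S\<^esub> w \<longleftrightarrow>
    u \<in> S \<and> w \<in> S \<and> (u = x \<and> w \<in> L \<or> u \<in> L \<and> w = x)"
  by (auto simp: star_graph_def arcs_ends_conv)

text \<open>A leaf of the centre's colour is joined to the centre by a single arc of the induced
  subgraph, so one step reaches everything that can be reached.\<close>

lemma mono_component_star_graph_centre:
  "mono_component (star_graph x L) col x = insert x {l \<in> L. col l = col x}" (is "?C = ?R")
proof
  let ?S = "{w \<in> pverts (star_graph x L). col w = col x}"
  \<comment> \<open>Reachability in the induced subgraph never leaves its vertex set, so no path has
    to be analysed here.\<close>
  show "?C \<subseteq> ?R"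
    by (auto simp: mono_component_def star_graph_def reachable_def dest: in_rtrancl_on_in_F(2))
  have "x \<in> ?S" by (simp add: star_graph_def)
  moreover have "x \<rightarrow>\<^sup>*\<^bsub>with_proj (star_graph x L) \<restriction> ?S\<^esub> l" if "l \<in> L" "col l = col x" for l
    using that unfolding reachable_def
    by (intro rtrancl_on_into_rtrancl_on[OF rtrancl_on_refl])
       (auto simp: arc_star_graph_induced_iff, auto simp: star_graph_def)
  ultimately show "?R \<subseteq> ?C"
    by (auto simp: mono_component_def reachable_def)
qed

text \<open>The only neighbour of the leaf is the centre, which has another colour, so the leaf is
  isolated in the subgraph induced by its own colour.\<close>

lemma mono_component_star_graph_leaf:
  assumes "l \<in> L" "col l \<noteq> col x"
  shows "mono_component (star_graph x L) col l = {l}"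
proof -
  let ?H = "with_proj (star_graph x L) \<restriction> {w \<in> pverts (star_graph x L). col w = col l}"
  have "u = l" if "l \<rightarrow>\<^sup>*\<^bsub>?H\<^esub> u" for u
    using that unfolding reachable_def
    by (induction rule: rtrancl_on_induct) (use assms in \<open>auto simp: arc_star_graph_induced_iff\<close>)
  moreover have "l \<rightarrow>\<^sup>*\<^bsub>?H\<^esub> l"
    using assms(1) by (simp add: reachable_def star_graph_def)
  ultimately show ?thesis
    by (auto simp: mono_component_def)
qed

text \<open>Every arc joins the centre to a leaf, so a move amounts to an arc whose ends differ in
  colour and a choice of the end to recolour: the centre, which takes its like-coloured leaves along
  (\<open>?A\<close>), or the leaf alone (\<open>?B\<close>).\<close>

lemma flag_moves_star_graph:
  "flag_moves (star_graph x L) col =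
    {(\<lambda>u. if u = x \<or> u \<in> L \<and> col u = col x then col l else col u) | l. l \<in> L \<and> col l \<noteq> col x} \<union>
    {col(l := col x) | l. l \<in> L \<and> col l \<noteq> col x}" (is "_ = ?A \<union> ?B")
proof (intro set_eqI iffI)
  fix q
  assume "q \<in> flag_moves (star_graph x L) col"
  then obtain v w where q: "q = (\<lambda>u. if u \<in> mono_component (star_graph x L) col v then col w else col u)"
    and "col w \<noteq> col v" "v = x \<and> w \<in> L \<or> v \<in> L \<and> w = x"
    unfolding flag_moves_def arc_star_graph_iff by blast
  then consider "v = x" "w \<in> L" "col w \<noteq> col x" | "v \<in> L" "w = x" "col v \<noteq> col x"
    by auto
  then show "q \<in> ?A \<union> ?B"
  proof cases
    case 1
    then show ?thesis
      using q by (auto simp: mono_component_star_graph_centre)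
  next
    case 2
    then have "q = col(v := col x)"
      using q by (auto simp: mono_component_star_graph_leaf)
    with 2 show ?thesis by blast
  qed
next
  fix q
  assume "q \<in> ?A \<union> ?B"
  then consider l where "l \<in> L" "col l \<noteq> col x"
      "q = (\<lambda>u. if u = x \<or> u \<in> L \<and> col u = col x then col l else col u)"
    | l where "l \<in> L" "col l \<noteq> col x" "q = col(l := col x)"
    by blast
  then show "q \<in> flag_moves (star_graph x L) col"
  proof cases
    case 1
    then show ?thesis
      unfolding flag_moves_def arc_star_graph_iff
      by (intro CollectI exI[of _ x] exI[of _ "col l"])
         (auto simp: mono_component_star_graph_centre, auto simp: star_graph_def)
  next
    case 2
    then show ?thesis
      unfolding flag_moves_def arc_star_graph_iff
      by (intro CollectI exI[of _ l] exI[of _ "col x"])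
         (auto simp: mono_component_star_graph_leaf, auto simp: star_graph_def)
  qed
qed

definition discordant_leaves :: "'v \<Rightarrow> 'v set \<Rightarrow> ('v \<Rightarrow> 'k) \<Rightarrow> 'v set" where
  "discordant_leaves x L col = {l \<in> L. col l \<noteq> col x}"

definition star_nimber :: "nat \<Rightarrow> nat" where
  "star_nimber n = (if n = 0 then 0 else if odd n then 1 else 2)"

text \<open>For \<open>n = 1\<close> the two listed values coincide, and the mex of
  \<open>{0}\<close> is 1. From then on the mex of \<open>{0, 1}\<close> is 2 and that of
  \<open>{0, 2}\<close> is 1, which gives the alternation.\<close>

lemma is_mex_star_nimber:
  "is_mex (star_nimber n) (if n = 0 then {} else {0, star_nimber (n - 1)})"
  by (cases n) (auto simp: is_mex_def star_nimber_def less_2_cases_iff)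

text \<open>The colouring need not be proper: a move destroys properness but introduces no new
  colour, so this is the form that the induction on the number of discordant leaves can
  carry.\<close>

lemma sg_value_star_graph:
  assumes "finite L" "x \<notin> L"
    and two_coloured: "\<forall>l \<in> L. col l = col x \<or> col l = b"
  shows "sg_value (flag_moves (star_graph x L)) col
           (star_nimber (card (discordant_leaves x L col)))"
  using two_coloured
proof (induction "card (discordant_leaves x L col)" arbitrary: col b rule: less_induct)
  case less
  let ?D = "discordant_leaves x L col"
  let ?P = "\<lambda>l u. if u = x \<or> u \<in> L \<and> col u = col x then col l else col u"
  let ?Q = "\<lambda>l. col(l := col x)"
  let ?g = "\<lambda>q. star_nimber (card (discordant_leaves x L q))"
  have opts: "flag_moves (star_graph x L) col = ?P ` ?D \<union> ?Q ` ?D"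
    by (auto simp: flag_moves_star_graph discordant_leaves_def)
  have fin: "finite ?D" using assms by (simp add: discordant_leaves_def)
  \<comment> \<open>All discordant leaves share the colour \<open>b\<close>; once the centre takes
    it, the whole star has colour \<open>b\<close>.\<close>
  have P: "discordant_leaves x L (?P l) = {}" if "l \<in> ?D" for l
    using that less.prems by (auto simp: discordant_leaves_def)
  have Q: "discordant_leaves x L (?Q l) = ?D - {l}" if "l \<in> ?D" for l
    using that assms(2) by (auto simp: discordant_leaves_def)
  have pos: "card ?D > 0" if "l \<in> ?D" for l
    using that fin by (auto simp: card_gt_0_iff)
  have "sg_value (flag_moves (star_graph x L)) (?P l) (?g (?P l))" if "l \<in> ?D" for l
  proof (rule less.hyps)
    show "card (discordant_leaves x L (?P l)) < card ?D"
      using P[OF that] pos[OF that] by simp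
    show "\<forall>k \<in> L. ?P l k = ?P l x \<or> ?P l k = b"
      using less.prems by auto
  qed
  moreover have "sg_value (flag_moves (star_graph x L)) (?Q l) (?g (?Q l))" if "l \<in> ?D" for l
  proof (rule less.hyps)
    show "card (discordant_leaves x L (?Q l)) < card ?D"
      using Q[OF that] pos[OF that] that by simp
    show "\<forall>k \<in> L. ?Q l k = ?Q l x \<or> ?Q l k = b"
      using less.prems by auto
  qed
  moreover have "?g ` flag_moves (star_graph x L) col =
      (if card ?D = 0 then {} else {0, star_nimber (card ?D - 1)})"
  proof (cases "card ?D = 0")
    case True
    then show ?thesis using fin by (simp add: opts)
  next
    case False
    \<comment> \<open>On each kind of option \<open>?g\<close> is constant; since \<open>?D\<close>
      is nonempty, both constants really occur.\<close>
    then have "?D \<noteq> {}" by auto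
    moreover have "?g (?P l) = 0" "?g (?Q l) = star_nimber (card ?D - 1)" if "l \<in> ?D" for l
      using P[OF that] Q[OF that] that by (simp_all add: star_nimber_def)
    ultimately show ?thesis
      using False by (simp add: opts image_Un image_image image_constant_conv insert_commute cong: image_cong_simp)
  qed
  ultimately show ?case
    by (intro sg_valueI[where g = ?g]) (auto simp: opts is_mex_star_nimber)
qed

theorem theorem1:
  fixes x :: 'v and L :: "'v set" and col :: "'v \<Rightarrow> 'k" and a b :: 'k and i :: nat
  assumes "finite L" and "x \<notin> L" and "card L = i"
    and "a \<noteq> b" and "col x = a" and "\<forall>l \<in> L. col l = b"
  shows "sg_value (flag_moves (star_graph x L)) col
           (if i = 0 then 0 else if odd i then 1 else 2)"
proof -
  \<comment> \<open>In the proper colouring every leaf differs from the centre, so the count is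
    \<open>i\<close>.\<close>
  have "discordant_leaves x L col = L"
    using assms by (auto simp: discordant_leaves_def)
  then show ?thesis
    using sg_value_star_graph[of L x col b] assms by (simp add: star_nimber_def)
qed

end
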